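(* Let $G$ be a full 1-plane graph (satisfying the kite-edge standing assumption) and let $S$ be a minimal separating set of $G$. Then there is a cycle $C$ in the radial graph $R(G)$ such that $C$ contains no dummy vertex, $V(C)\cap V(G)=S$, and there are vertices of $G$ both inside and outside $C$ (with respect to the planar drawing of $\Lambda(G)$).
   Context: Graphs are connected, have no loops, and may have parallel edges. A 1-plane graph is a graph $G$ together with a drawing in the plane that is good (edges are simple curves; two edges intersect only at a common endpoint or at a proper crossing; any two edges intersect at most once; no three edges cross at one point) and in which every edge is crossed at most once. For a crossing of edges $(u,v)$ and $(w,x)$, the four distinct vertices $u,v,w,x$ are its endpoints; two endpoints are consecutive if they are not $\{u,v\}$ and not $\{w,x\}$. A crossing is full if every two consecutive endpoints are adjacent in $G$ (so the endpoints induce $K_4$ in the underlying simple graph); $G$ is full 1-plane if all its crossings are full. The planarization $G^\times$ is the plane graph obtained by replacing each crossing point by a new dummy vertex adjacent to the four endpoints of that crossing. An edge of $G$ joining consecutive endpoints $u,x$ of a crossing with dummy vertex $c$ is a kite edge if it is uncrossed and $G^\times$ has a face bounded exactly by this edge and the edges $(u,c),(c,x)$. Standing assumption: for every crossing and every pair of consecutive endpoints that are adjacent in $G$, some edge joining them is a kite edge of that crossing. The radial planarization $\Lambda(G)$ is the plane graph obtained from $G^\times$ by inserting a new face vertex $f_F$ inside each face $F$ of $G^\times$ and, for each occurrence of a vertex $v$ on the boundary walk of $F$, an edge $(v,f_F)$ drawn inside $F$ (repeated occurrences give parallel edges). The radial graph $R(G)$ is the subgraph of $\Lambda(G)$ consisting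 of all edges incident to face vertices. A separating set of $G$ is a set $S\subseteq V(G)$ such that $G-S$ is disconnected; it is minimal if no proper subset is separating. *)

theory Defs
  imports Main
begin

section \<open>Combinatorial model of the planarization G^x of a 1-plane graph\<close>

text \<open>
  The planarization G^x is represented as a combinatorial map (rotation system):
  a finite set of darts D (half-edges), a fixed-point-free involution alpha
  (the other half of the same edge), a rotation sigma (cyclic order of the darts
  around their common tail vertex) and a tail function tail.  Faces are the orbits
  of phi = sigma o alpha (the boundary walks).  Connectedness plus the Euler
  formula V - E + F = 2 expresses that the map is a plane (genus 0) embedding.
  The set dummy marks the dummy (crossing) vertices.
\<close>

definition head :: "('d \<Rightarrow> 'd) \<Rightarrow> ('d \<Rightarrow> 'v) \<Rightarrow> 'd \<Rightarrow> 'v" where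
  "head alpha tail d = tail (alpha d)"

definition face_of :: "('d \<Rightarrow> 'd) \<Rightarrow> ('d \<Rightarrow> 'd) \<Rightarrow> 'd \<Rightarrow> 'd set" where
  "face_of alpha sigma d = range (\<lambda>n. ((sigma \<circ> alpha) ^^ n) d)"

definition plane_map ::
  "'d set \<Rightarrow> ('d \<Rightarrow> 'd) \<Rightarrow> ('d \<Rightarrow> 'd) \<Rightarrow> ('d \<Rightarrow> 'v) \<Rightarrow> bool" where
  "plane_map D alpha sigma tail \<longleftrightarrow>
     finite D \<and>
     (\<forall>d\<in>D. alpha d \<in> D \<and> alpha d \<noteq> d \<and> alpha (alpha d) = d \<and> tail (alpha d) \<noteq> tail d) \<and>
     bij_betw sigma D D \<and>
     (\<forall>d\<in>D. tail (sigma d) = tail d) \<and>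
     (\<forall>d\<in>D. \<forall>d'\<in>D. tail d = tail d' \<longrightarrow> (\<exists>n. (sigma ^^ n) d = d')) \<and>
     (\<forall>d\<in>D. \<forall>d'\<in>D. (d, d') \<in> ({(x, sigma x) | x. x \<in> D} \<union> {(x, alpha x) | x. x \<in> D})\<^sup>*) \<and>
     2 * card (tail ` D) + 2 * card (face_of alpha sigma ` D) = card D + 4"

text \<open>Planarization of a good 1-plane drawing: each dummy vertex has degree 4,
  its four neighbours are four distinct non-dummy vertices (so no edge is crossed
  twice, adjacent edges do not cross, no three edges cross at a point), and the
  two crossing edges are formed by opposite darts in the rotation at the dummy.\<close>

definition one_plane_planarization ::
  "'d set \<Rightarrow> ('d \<Rightarrow> 'd) \<Rightarrow> ('d \<Rightarrow> 'd) \<Rightarrow> ('d \<Rightarrow> 'v) \<Rightarrow> 'v set \<Rightarrow> bool" where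
  "one_plane_planarization D alpha sigma tail dummy \<longleftrightarrow>
     plane_map D alpha sigma tail \<and>
     dummy \<subseteq> tail ` D \<and>
     (\<forall>c\<in>dummy. card {d\<in>D. tail d = c} = 4) \<and>
     (\<forall>d\<in>D. tail d \<in> dummy \<longrightarrow>
        head alpha tail d \<notin> dummy \<and>
        distinct [head alpha tail d, head alpha tail (sigma d),
                  head alpha tail (sigma (sigma d)), head alpha tail (sigma (sigma (sigma d)))])"

text \<open>The underlying graph G: non-dummy vertices; edges are the uncrossed edges
  of G^x between non-dummy vertices, and the crossed edges formed by opposite
  darts at a dummy vertex.\<close>

definition gV :: "'d set \<Rightarrow> ('d \<Rightarrow> 'v) \<Rightarrow> 'v set \<Rightarrow> 'v set" where
  "gV D tail dummy = tail ` D - dummy"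

definition gadj ::
  "'d set \<Rightarrow> ('d \<Rightarrow> 'd) \<Rightarrow> ('d \<Rightarrow> 'd) \<Rightarrow> ('d \<Rightarrow> 'v) \<Rightarrow> 'v set \<Rightarrow> 'v \<Rightarrow> 'v \<Rightarrow> bool" where
  "gadj D alpha sigma tail dummy u v \<longleftrightarrow>
     (\<exists>d\<in>D. tail d = u \<and> head alpha tail d = v \<and> u \<notin> dummy \<and> v \<notin> dummy) \<or>
     (\<exists>d\<in>D. tail d \<in> dummy \<and> head alpha tail d = u \<and> head alpha tail (sigma (sigma d)) = v)"

definition g_connected ::
  "'d set \<Rightarrow> ('d \<Rightarrow> 'd) \<Rightarrow> ('d \<Rightarrow> 'd) \<Rightarrow> ('d \<Rightarrow> 'v) \<Rightarrow> 'v set \<Rightarrow> bool" where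
  "g_connected D alpha sigma tail dummy \<longleftrightarrow>
     (\<forall>u\<in>gV D tail dummy. \<forall>v\<in>gV D tail dummy. (gadj D alpha sigma tail dummy)\<^sup>*\<^sup>* u v)"

text \<open>Full: consecutive endpoints (head d, head (sigma d)) of every crossing are adjacent.\<close>

definition full ::
  "'d set \<Rightarrow> ('d \<Rightarrow> 'd) \<Rightarrow> ('d \<Rightarrow> 'd) \<Rightarrow> ('d \<Rightarrow> 'v) \<Rightarrow> 'v set \<Rightarrow> bool" where
  "full D alpha sigma tail dummy \<longleftrightarrow>
     (\<forall>d\<in>D. tail d \<in> dummy \<longrightarrow>
        gadj D alpha sigma tail dummy (head alpha tail d) (head alpha tail (sigma d)))"

text \<open>e is a kite edge of the crossing at tail d for the consecutive endpoints
  head d, head (sigma d): it is an uncrossed edge joining them and G^x has a face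
  whose boundary consists exactly of e and the two half-edges to the dummy.\<close>

definition kite_edge ::
  "'d set \<Rightarrow> ('d \<Rightarrow> 'd) \<Rightarrow> ('d \<Rightarrow> 'd) \<Rightarrow> ('d \<Rightarrow> 'v) \<Rightarrow> 'v set \<Rightarrow> 'd \<Rightarrow> 'd \<Rightarrow> bool" where
  "kite_edge D alpha sigma tail dummy d e \<longleftrightarrow>
     e \<in> D \<and> tail e \<notin> dummy \<and> head alpha tail e \<notin> dummy \<and>
     {tail e, head alpha tail e} = {head alpha tail d, head alpha tail (sigma d)} \<and>
     (\<exists>f\<in>{e, alpha e}. \<exists>g\<in>{d, alpha d}. \<exists>h\<in>{sigma d, alpha (sigma d)}.
        face_of alpha sigma f = {f, g, h})"

definition kite_assumption ::
  "'d set \<Rightarrow> ('d \<Rightarrow> 'd) \<Rightarrow> ('d \<Rightarrow> 'd) \<Rightarrow> ('d \<Rightarrow> 'v) \<Rightarrow> 'v set \<Rightarrow> bool" where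
  "kite_assumption D alpha sigma tail dummy \<longleftrightarrow>
     (\<forall>d\<in>D. tail d \<in> dummy \<longrightarrow>
        gadj D alpha sigma tail dummy (head alpha tail d) (head alpha tail (sigma d)) \<longrightarrow>
        (\<exists>e\<in>D. kite_edge D alpha sigma tail dummy d e))"

section \<open>Separating sets\<close>

definition separating ::
  "'d set \<Rightarrow> ('d \<Rightarrow> 'd) \<Rightarrow> ('d \<Rightarrow> 'd) \<Rightarrow> ('d \<Rightarrow> 'v) \<Rightarrow> 'v set \<Rightarrow> 'v set \<Rightarrow> bool" where
  "separating D alpha sigma tail dummy S \<longleftrightarrow>
     S \<subseteq> gV D tail dummy \<and>
     (\<exists>u v. u \<in> gV D tail dummy - S \<and> v \<in> gV D tail dummy - S \<and>
        \<not> (\<lambda>x y. gadj D alpha sigma tail dummy x y \<and> x \<notin> S \<and> y \<notin> S)\<^sup>*\<^sup>* u v)"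

definition minimal_separating ::
  "'d set \<Rightarrow> ('d \<Rightarrow> 'd) \<Rightarrow> ('d \<Rightarrow> 'd) \<Rightarrow> ('d \<Rightarrow> 'v) \<Rightarrow> 'v set \<Rightarrow> 'v set \<Rightarrow> bool" where
  "minimal_separating D alpha sigma tail dummy S \<longleftrightarrow>
     separating D alpha sigma tail dummy S \<and>
     (\<forall>T. T \<subset> S \<longrightarrow> \<not> separating D alpha sigma tail dummy T)"

section \<open>Radial graph and cycles\<close>

text \<open>Cycle in a multigraph (edge set E, endpoint function ends): distinct
  vertices vs and distinct edges es, edge i joining vs!i and vs!(i+1 mod n), n >= 2.\<close>

definition mg_cycle :: "('e \<Rightarrow> 'a set) \<Rightarrow> 'e set \<Rightarrow> 'a list \<Rightarrow> 'e list \<Rightarrow> bool" where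
  "mg_cycle ends E vs es \<longleftrightarrow>
     length vs \<ge> 2 \<and> length es = length vs \<and> distinct vs \<and> distinct es \<and> set es \<subseteq> E \<and>
     (\<forall>i<length vs. ends (es ! i) = {vs ! i, vs ! (Suc i mod length vs)})"

text \<open>Radial graph R(G): vertices Inl v (vertices of G^x) and Inr F (face vertices);
  one edge (v, f_F) per occurrence of v on the boundary walk of F, i.e. per dart of
  G^x (dart d gives the occurrence of its tail in its face).\<close>

definition radial_ends :: "('d \<Rightarrow> 'd) \<Rightarrow> ('d \<Rightarrow> 'd) \<Rightarrow> ('d \<Rightarrow> 'v) \<Rightarrow> 'd \<Rightarrow> ('v + 'd set) set" where
  "radial_ends alpha sigma tail d = {Inl (tail d), Inr (face_of alpha sigma d)}"

text \<open>Sides of a radial cycle with edge set ES in the plane graph Lambda(G).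
  The faces of Lambda(G) are triangles, one per dart d of G^x (tail d, head d,
  face vertex of d). The triangle of d shares the edge of G^x with the triangle of
  alpha d, and the radial edge (dart) sigma (alpha d) with the triangle of
  sigma (alpha d). Two faces of Lambda(G) lie on the same side of the cycle iff they
  are joined by a chain of faces crossing only edges not on the cycle.\<close>

definition side_rel :: "'d set \<Rightarrow> ('d \<Rightarrow> 'd) \<Rightarrow> ('d \<Rightarrow> 'd) \<Rightarrow> 'd set \<Rightarrow> 'd rel" where
  "side_rel D alpha sigma ES =
     (let r = {(d, alpha d) | d. d \<in> D} \<union> {(d, sigma (alpha d)) | d. d \<in> D \<and> sigma (alpha d) \<notin> ES}
      in (r \<union> r\<inverse>)\<^sup>*)"

text \<open>Vertices u, w (not on the cycle) lie on different sides (one inside, one outside).\<close>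

definition opposite_sides ::
  "'d set \<Rightarrow> ('d \<Rightarrow> 'd) \<Rightarrow> ('d \<Rightarrow> 'd) \<Rightarrow> ('d \<Rightarrow> 'v) \<Rightarrow> 'd set \<Rightarrow> 'v \<Rightarrow> 'v \<Rightarrow> bool" where
  "opposite_sides D alpha sigma tail ES u w \<longleftrightarrow>
     (\<exists>du\<in>D. \<exists>dw\<in>D. tail du = u \<and> tail dw = w \<and> (du, dw) \<notin> side_rel D alpha sigma ES)"

end

theory Submission
  imports Defs
begin

text \<open>
  Work with edge sets modulo 2 in the radial graph. Its faces correspond to the edges of the
  planarization, and every boundary of a set of faces has even degree everywhere. By Euler's formula
  there are as many boundaries as edge sets of even degree, so every cycle of the radial graph is a
  boundary.

  Let u and w be separated by S. By fullness no dummy vertex touches two components of G - S, so the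
  faces around the component of u form a region whose boundary only uses radial edges at S. Some cycle
  inside this boundary still separates u from w. Edges of G cannot cross a radial cycle that avoids
  the dummy vertices, hence the vertices of G on the cycle form a separating subset of S, which is S
  by minimality.
\<close>

section \<open>Edge sets over the two-element field\<close>

lemma odd_card_sym_diff:
  assumes "finite A" "finite B"
  shows "odd (card (sym_diff A B)) \<longleftrightarrow> odd (card A) \<noteq> odd (card B)"
proof -
  have "card (sym_diff A B) = card (A - B) + card (B - A)"
    using assms by (intro card_Un_disjoint) auto
  moreover have "card A = card (A - B) + card (A \<inter> B)"
    using assms by (subst card_Un_disjoint [symmetric]) (auto intro: arg_cong [where f = card])
  moreover have "card B = card (B - A) + card (A \<inter> B)"
    using assms by (subst card_Un_disjoint [symmetric]) (auto intro: arg_cong [where f = card])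
  ultimately show ?thesis
    by presburger
qed

text \<open>Rank-nullity for groups under symmetric difference: the nonempty fibres of
  \<open>f\<close> are translates of its kernel, so they all have the same size.\<close>

lemma card_image_times_kernel:
  fixes f :: "'a set \<Rightarrow> 'b set"
  assumes fin: "finite G"
    and closed: "\<And>A B. A \<in> G \<Longrightarrow> B \<in> G \<Longrightarrow> sym_diff A B \<in> G"
    and additive: "\<And>A B. A \<in> G \<Longrightarrow> B \<in> G \<Longrightarrow> f (sym_diff A B) = sym_diff (f A) (f B)"
  shows "card G = card (f ` G) * card {A \<in> G. f A = {}}"
proof -
  have fibre: "card {A \<in> G. f A = y} = card {A \<in> G. f A = {}}" if "y \<in> f ` G" for y
  proof -
    obtain B where B: "B \<in> G" "y = f B"
      using \<open>y \<in> f ` G\<close> by blast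
    have invol: "sym_diff B (sym_diff B A) = A" for A
      by blast
    have "bij_betw (sym_diff B) {A \<in> G. f A = y} {A \<in> G. f A = {}}"
      by (rule bij_betw_byWitness [where f' = "sym_diff B"])
        (use B closed [OF B(1)] additive [OF B(1)] invol in auto)
    then show ?thesis
      by (rule bij_betw_same_card)
  qed
  have "card G = (\<Sum>y\<in>f ` G. card {A \<in> G. f A = y})"
    using sum.image_gen [OF fin, of "\<lambda>_. 1::nat" f] by simp
  then show ?thesis
    by (simp add: fibre)
qed

text \<open>When every edge has two ends, this is the boundary map from edge chains to vertex chains
  modulo 2; its kernel is the cycle space.\<close>

definition odd_vertices :: "('e \<Rightarrow> 'a set) \<Rightarrow> 'e set \<Rightarrow> 'a set" where
  "odd_vertices ends A = {w. odd (card {e \<in> A. w \<in> ends e})}"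

lemma odd_vertices_sym_diff:
  assumes "finite A" "finite B"
  shows "odd_vertices ends (sym_diff A B) = sym_diff (odd_vertices ends A) (odd_vertices ends B)"
proof -
  have "odd (card {e \<in> sym_diff A B. w \<in> ends e}) \<longleftrightarrow>
      odd (card {e \<in> A. w \<in> ends e}) \<noteq> odd (card {e \<in> B. w \<in> ends e})" for w
  proof -
    have "{e \<in> sym_diff A B. w \<in> ends e} = sym_diff {e \<in> A. w \<in> ends e} {e \<in> B. w \<in> ends e}"
      by blast
    then show ?thesis
      using odd_card_sym_diff [of "{e \<in> A. w \<in> ends e}" "{e \<in> B. w \<in> ends e}"] assms by simp
  qed
  then show ?thesis
    unfolding odd_vertices_def by blast
qed

lemma odd_vertices_singleton: "odd_vertices ends {e} = ends e"
proof -
  have "{x \<in> {e}. w \<in> ends x} = (if w \<in> ends e then {e} else {})" for w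
    by auto
  then show ?thesis
    by (simp add: odd_vertices_def)
qed

text \<open>In a connected graph every vertex set \<open>T\<close> or \<open>T\<close> with \<open>r\<close> switched is the set of
  odd vertices of some edge set; hence half of all vertex sets occur.\<close>

lemma card_even_edge_sets_le:
  assumes E: "finite E" and W: "finite W"
    and conn: "\<And>w. w \<in> W \<Longrightarrow> sym_diff {w} {r} \<in> odd_vertices ends ` Pow E"
  shows "2 ^ card W * card {A \<in> Pow E. odd_vertices ends A = {}} \<le> 2 * 2 ^ card E"
proof -
  let ?I = "odd_vertices ends ` Pow E"
  have additive: "odd_vertices ends (sym_diff A B) =
      sym_diff (odd_vertices ends A) (odd_vertices ends B)" if "A \<in> Pow E" "B \<in> Pow E" for A B
    using that E by (intro odd_vertices_sym_diff) (auto dest: finite_subset)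
  have I_sym_diff: "sym_diff P Q \<in> ?I" if "P \<in> ?I" "Q \<in> ?I" for P Q
  proof -
    from that obtain A B where AB: "A \<in> Pow E" "B \<in> Pow E"
      "P = odd_vertices ends A" "Q = odd_vertices ends B"
      by blast
    then have "sym_diff P Q = odd_vertices ends (sym_diff A B)"
      by (simp add: additive)
    moreover have "sym_diff A B \<in> Pow E"
      using AB by blast
    ultimately show ?thesis
      by blast
  qed
  have cover: "T \<in> ?I \<or> sym_diff T {r} \<in> ?I" if "finite T" "T \<subseteq> W" for T
    using that
  proof (induction T)
    case empty
    have "odd_vertices ends {} = {}"
      by (simp add: odd_vertices_def)
    then show ?case
      by (metis Pow_bottom image_eqI)
  next
    case (insert x T)
    have x: "sym_diff {x} {r} \<in> ?I"
      using insert by (intro conn) simp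
    from insert consider "T \<in> ?I" | "sym_diff T {r} \<in> ?I"
      by blast
    then show ?case
    proof cases
      case 1
      have "sym_diff (insert x T) {r} = sym_diff T (sym_diff {x} {r})"
        using insert(2) by blast
      then show ?thesis
        using I_sym_diff [OF 1 x] by simp
    next
      case 2
      have "insert x T = sym_diff (sym_diff T {r}) (sym_diff {x} {r})"
        using insert(2) by blast
      then show ?thesis
        using I_sym_diff [OF 2 x] by simp
    qed
  qed
  have finI: "finite ?I"
    using E by simp
  \<comment> \<open>Switching \<open>r\<close> twice changes nothing, so \<open>?I\<close> and its
    translate by \<open>{r}\<close> cover \<open>Pow W\<close>.\<close>
  have "Pow W \<subseteq> ?I \<union> (\<lambda>T. sym_diff T {r}) ` ?I"
  proof
    fix T
    assume "T \<in> Pow W"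
    then have "T \<in> ?I \<or> sym_diff T {r} \<in> ?I"
      using cover [of T] W finite_subset by blast
    moreover have "T = sym_diff (sym_diff T {r}) {r}"
      by blast
    ultimately show "T \<in> ?I \<union> (\<lambda>T. sym_diff T {r}) ` ?I"
      by blast
  qed
  then have "card (Pow W) \<le> card (?I \<union> (\<lambda>T. sym_diff T {r}) ` ?I)"
    using finI by (intro card_mono) auto
  also have "\<dots> \<le> card ?I + card ((\<lambda>T. sym_diff T {r}) ` ?I)"
    by (rule card_Un_le)
  also have "\<dots> \<le> 2 * card ?I"
    using card_image_le [OF finI, of "\<lambda>T. sym_diff T {r}"] by simp
  finally have "2 ^ card W \<le> 2 * card ?I"
    using W by (simp add: card_Pow)
  then have "2 ^ card W * card {A \<in> Pow E. odd_vertices ends A = {}} \<le>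
      2 * (card ?I * card {A \<in> Pow E. odd_vertices ends A = {}})"
    by simp
  \<comment> \<open>A large image of \<open>odd_vertices\<close> forces a small kernel.\<close>
  also have "card ?I * card {A \<in> Pow E. odd_vertices ends A = {}} = card (Pow E)"
    by (rule card_image_times_kernel [symmetric]) (use E additive in auto)
  finally show ?thesis
    using E by (simp add: card_Pow)
qed

section \<open>Cycles\<close>

text \<open>Take a longest path. Its first vertex has a second edge, whose other end lies on the
  path by maximality; this edge closes an initial segment to a cycle, possibly of length
  two.\<close>

lemma ex_mg_cycle:
  assumes fin: "finite B" and ne: "B \<noteq> {}"
    and two: "\<And>e. e \<in> B \<Longrightarrow> card (ends e) = 2"
    and deg: "\<And>w. card {e \<in> B. w \<in> ends e} \<noteq> 1"
  shows "\<exists>vs es. mg_cycle ends B vs es"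
proof -
  \<comment> \<open>At least one edge is required, so that \<open>es ! 0\<close> exists as the path
    edge at the first vertex.\<close>
  define P where "P = (\<lambda>(vs, es). distinct vs \<and> length vs = Suc (length es) \<and> es \<noteq> [] \<and>
    set es \<subseteq> B \<and> (\<forall>i<length es. ends (es ! i) = {vs ! i, vs ! Suc i}))"
  have PD: "distinct vs" "length vs = Suc (length es)" "es \<noteq> []" "set es \<subseteq> B"
    "\<And>i. i < length es \<Longrightarrow> ends (es ! i) = {vs ! i, vs ! Suc i}" if "P (vs, es)" for vs es
    using that unfolding P_def by auto
  have fin_ends: "finite (\<Union>(ends ` B))"
    using fin two by (auto intro!: card_ge_0_finite)
  have len: "length vs \<le> card (\<Union>(ends ` B))" if p: "P (vs, es)" for vs es
  proof -
    have "vs ! i \<in> \<Union>(ends ` B)" if i: "i < length vs" for i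
    proof (cases i)
      case 0
      then have "vs ! i \<in> ends (es ! 0)" "es ! 0 \<in> B"
        using PD(3-5) [OF p] by auto
      then show ?thesis
        by blast
    next
      case (Suc j)
      then have "vs ! i \<in> ends (es ! j)" "es ! j \<in> B"
        using PD(2,4,5) [OF p] i by auto
      then show ?thesis
        by blast
    qed
    then have "set vs \<subseteq> \<Union>(ends ` B)"
      by (auto simp: in_set_conv_nth)
    then show ?thesis
      using PD(1) [OF p] fin_ends by (metis card_mono distinct_card)
  qed
  obtain e where e: "e \<in> B"
    using ne by blast
  obtain x y where "ends e = {x, y}" "x \<noteq> y"
    using two [OF e] by (auto simp: card_2_iff)
  then have "P ([x, y], [e])"
    using e by (simp add: P_def)
  moreover have "\<forall>p. P p \<longrightarrow> length (fst p) < Suc (card (\<Union>(ends ` B)))"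
    using len by (auto simp: less_Suc_eq_le)
  ultimately obtain p where p: "P p" and p_max: "\<And>q. P q \<Longrightarrow> length (fst q) \<le> length (fst p)"
    using ex_has_greatest_nat [of P _ "length \<circ> fst"] by (metis comp_apply)
  obtain vs es where vs_es: "p = (vs, es)"
    by (cases p)
  note pd = PD [OF p [unfolded vs_es]]
  define v where "v = vs ! 0"
  have es0: "es ! 0 \<in> {e \<in> B. v \<in> ends e}"
    using pd(3-5) by (auto simp: v_def)
  have "{e \<in> B. v \<in> ends e} \<noteq> {es ! 0}"
    using deg [of v] by force
  then obtain f where f: "f \<in> B" "v \<in> ends f" "f \<noteq> es ! 0"
    using es0 by blast
  obtain a b where "ends f = {a, b}" "a \<noteq> b"
    using two [OF f(1)] by (auto simp: card_2_iff)
  then obtain w where w: "ends f = {w, v}" "w \<noteq> v"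
    using f(2) that [of "if v = a then b else a"] by auto
  have "w \<in> set vs"
  proof (rule ccontr)
    assume "w \<notin> set vs"
    then have "P (w # vs, f # es)"
      using pd f w by (auto simp: P_def v_def nth_Cons split: nat.split)
    then show False
      using p_max vs_es by fastforce
  qed
  then obtain j where j: "j < length vs" "w = vs ! j"
    by (auto simp: in_set_conv_nth)
  then have j_le: "j \<le> length es" and j_pos: "0 < j"
    using pd(2) w(2) by (auto simp: v_def intro: Suc_leI gr0I)
  \<comment> \<open>The segment from \<open>v\<close> to \<open>w\<close> is closed by
    \<open>f\<close>; for \<open>j = 1\<close> the edge \<open>f\<close> is parallel to
    \<open>es ! 0\<close>.\<close>
  define us where "us = take (Suc j) vs"
  define fs where "fs = take j es @ [f]"
  have f_notin: "f \<notin> set es"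
  proof
    assume "f \<in> set es"
    then obtain i where i: "i < length es" "f = es ! i"
      by (auto simp: in_set_conv_nth)
    then have "v \<in> {vs ! i, vs ! Suc i}"
      using pd(5) f(2) by blast
    then have "i = 0"
      using pd(1,2) i(1) by (auto simp: v_def nth_eq_iff_index_eq)
    then show False
      using f(3) i(2) by simp
  qed
  have dist_es: "distinct es"
  proof (unfold distinct_conv_nth, intro allI impI notI)
    fix i k
    assume ik: "i < length es" "k < length es" "i \<noteq> k" "es ! i = es ! k"
    then have "{vs ! i, vs ! Suc i} = {vs ! k, vs ! Suc k}"
      using pd(5) by metis
    then show False
      using ik pd(1,2) by (auto simp: doubleton_eq_iff nth_eq_iff_index_eq)
  qed
  have "mg_cycle ends B us fs"
    unfolding mg_cycle_def
  proof (intro conjI allI impI)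
    show "2 \<le> length us" "length fs = length us" "distinct us"
      using j j_le j_pos pd(1) by (auto simp: us_def fs_def)
    show "distinct fs" "set fs \<subseteq> B"
      using f_notin f(1) pd(4) dist_es by (auto simp: fs_def dest: in_set_takeD)
    fix i
    assume "i < length us"
    then have "i < j \<or> i = j"
      using j by (auto simp: us_def)
    then show "ends (fs ! i) = {us ! i, us ! (Suc i mod length us)}"
    proof
      assume "i < j"
      then show ?thesis
        using j j_le pd(5) by (simp add: us_def fs_def nth_append)
    next
      assume "i = j"
      then show ?thesis
        using j j_le w by (simp add: us_def fs_def nth_append v_def)
    qed
  qed
  then show ?thesis
    by blast
qed

lemma mg_cycle_vertex_in_edge:
  assumes "mg_cycle ends E vs es" "w \<in> set vs"
  shows "\<exists>e\<in>set es. w \<in> ends e"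
proof -
  obtain i where "i < length vs" "w = vs ! i"
    using assms(2) by (auto simp: in_set_conv_nth)
  then show ?thesis
    using assms(1) unfolding mg_cycle_def by (intro bexI [of _ "es ! i"]) auto
qed

lemma mg_cycle_edge_ends:
  assumes "mg_cycle ends E vs es" "e \<in> set es"
  shows "ends e \<subseteq> set vs"
proof -
  obtain i where i: "i < length vs" "e = es ! i"
    using assms by (auto simp: in_set_conv_nth mg_cycle_def)
  then have "Suc i mod length vs < length vs"
    by (intro mod_less_divisor) linarith
  then show ?thesis
    using assms(1) i unfolding mg_cycle_def by auto
qed

lemma mg_cycle_even:
  assumes "mg_cycle ends E vs es"
  shows "odd_vertices ends (set es) = {}"
proof -
  define n where "n = length vs"
  have n: "2 \<le> n" "length es = n" "distinct vs" "distinct es"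
    "\<And>i. i < n \<Longrightarrow> ends (es ! i) = {vs ! i, vs ! (Suc i mod n)}"
    using assms unfolding mg_cycle_def n_def by auto
  have "even (card {e \<in> set es. w \<in> ends e})" for w
  proof (cases "w \<in> set vs")
    case False
    then have "{e \<in> set es. w \<in> ends e} = {}"
      using mg_cycle_edge_ends [OF assms] by blast
    then show ?thesis
      by (simp only: card.empty even_zero)
  next
    case True
    then obtain j where j: "j < n" "w = vs ! j"
      by (auto simp: in_set_conv_nth n_def)
    \<comment> \<open>The edges at position \<open>j\<close> and at its cyclic predecessor
      \<open>k\<close> are the two edges at \<open>w\<close>; length at least two keeps the
      positions distinct.\<close>
    define k where "k = (if j = 0 then n - 1 else j - 1)"
    have k: "k < n" "k \<noteq> j"
      using j n(1) by (auto simp: k_def)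
    have inc: "w \<in> ends (es ! i) \<longleftrightarrow> i = j \<or> i = k" if i: "i < n" for i
    proof -
      have m: "Suc i mod n = (if Suc i = n then 0 else Suc i)"
        using i by simp
      have "w \<in> ends (es ! i) \<longleftrightarrow> j = i \<or> j = Suc i mod n"
        using i j(1) n(1) by (simp add: n(5) j(2) nth_eq_iff_index_eq [OF n(3)] flip: n_def)
      then show ?thesis
        using i j(1) n(1) by (auto simp: m k_def)
    qed
    have "{e \<in> set es. w \<in> ends e} = {es ! j, es ! k}"
      using inc j(1) k(1) n(2) by (auto simp: in_set_conv_nth)
    moreover have "es ! j \<noteq> es ! k"
      using n(2,4) j(1) k by (simp add: nth_eq_iff_index_eq)
    ultimately show ?thesis
      by (simp only: card_2_iff) simp
  qed
  then show ?thesis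
    by (simp add: odd_vertices_def)
qed

section \<open>Combinatorial maps on the sphere\<close>

locale sphere_map =
  fixes D :: "'d set" and alpha sigma :: "'d \<Rightarrow> 'd" and tail :: "'d \<Rightarrow> 'v"
  assumes plane_map: "plane_map D alpha sigma tail"
begin

section \<open>Darts, rotations and face orbits\<close>

lemma finite_D: "finite D"
  and alpha_in: "d \<in> D \<Longrightarrow> alpha d \<in> D"
  and alpha_alpha: "d \<in> D \<Longrightarrow> alpha (alpha d) = d"
  and bij_sigma: "bij_betw sigma D D"
  and tail_sigma: "d \<in> D \<Longrightarrow> tail (sigma d) = tail d"
  and same_tail: "d \<in> D \<Longrightarrow> d' \<in> D \<Longrightarrow> tail d = tail d' \<Longrightarrow> \<exists>n. (sigma ^^ n) d = d'"
  and connected: "d \<in> D \<Longrightarrow> d' \<in> D \<Longrightarrow>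
    (d, d') \<in> ({(x, sigma x) | x. x \<in> D} \<union> {(x, alpha x) | x. x \<in> D})\<^sup>*"
  and euler: "2 * card (tail ` D) + 2 * card (face_of alpha sigma ` D) = card D + 4"
  using plane_map unfolding plane_map_def by simp_all

abbreviation phi :: "'d \<Rightarrow> 'd" where
  "phi \<equiv> sigma \<circ> alpha"

abbreviation face :: "'d \<Rightarrow> 'd set" where
  "face \<equiv> face_of alpha sigma"

abbreviation ends :: "'d \<Rightarrow> ('v + 'd set) set" where
  "ends \<equiv> radial_ends alpha sigma tail"

lemma sigma_in: "d \<in> D \<Longrightarrow> sigma d \<in> D"
  using bij_sigma by (auto simp: bij_betw_def)

lemma sigma_funpow_in: "d \<in> D \<Longrightarrow> (sigma ^^ n) d \<in> D"
  by (induction n) (auto intro: sigma_in)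

lemma sigma_eq_iff: "x \<in> D \<Longrightarrow> y \<in> D \<Longrightarrow> sigma x = sigma y \<longleftrightarrow> x = y"
  using bij_sigma by (auto simp: bij_betw_def inj_on_eq_iff)

lemma sigma_image_iff: "Y \<subseteq> D \<Longrightarrow> d \<in> D \<Longrightarrow> sigma d \<in> sigma ` Y \<longleftrightarrow> d \<in> Y"
  by (auto simp: sigma_eq_iff subset_eq)

lemma ex_sigma: "d \<in> D \<Longrightarrow> \<exists>d'\<in>D. d = sigma d'"
  using bij_sigma by (auto simp: bij_betw_def)

lemma tail_funpow: "d \<in> D \<Longrightarrow> tail ((sigma ^^ n) d) = tail d"
  by (induction n) (auto simp: tail_sigma sigma_funpow_in)

lemma phi_in: "d \<in> D \<Longrightarrow> phi d \<in> D"
  by (simp add: alpha_in sigma_in)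

lemma inj_phi: "inj_on phi D"
  by (rule inj_onI) (metis alpha_alpha alpha_in comp_apply sigma_eq_iff)

text \<open>Faces are forward orbits. As \<open>phi\<close> is injective on the finite set
  \<open>D\<close>, it maps each such orbit onto itself, so starting one dart later gives the same
  face.\<close>

lemma face_phi:
  assumes "d \<in> D"
  shows "face (phi d) = face d"
proof -
  have sub: "face d \<subseteq> D"
  proof -
    have "(phi ^^ n) d \<in> D" for n
      using assms phi_in by (induction n) auto
    then show ?thesis
      by (auto simp: face_of_def)
  qed
  have img: "face (phi d) = phi ` face d"
    unfolding face_of_def image_image by (simp add: funpow_swap1)
  have "(phi ^^ Suc n) d \<in> face d" for n
    unfolding face_of_def by blast
  then have "phi ` face d \<subseteq> face d"
    by (auto simp: face_of_def)
  then have "phi ` face d = face d"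
    using sub finite_D inj_phi by (intro endo_inj_surj) (auto intro: finite_subset inj_on_subset)
  then show ?thesis
    using img by simp
qed

lemma face_alpha:
  assumes "d \<in> D"
  shows "face (alpha d) = face (sigma d)"
  using face_phi [OF alpha_in [OF assms]] assms by (simp add: alpha_alpha)

lemma connected_induct:
  assumes "d \<in> D" "d' \<in> D" "P d"
    and "\<And>x. x \<in> D \<Longrightarrow> P x \<Longrightarrow> P (sigma x)"
    and "\<And>x. x \<in> D \<Longrightarrow> P x \<Longrightarrow> P (alpha x)"
  shows "P d'"
  using connected [OF assms(1,2)] by (induction rule: rtrancl_induct) (use assms(3-) in auto)

subsection \<open>Boundaries\<close>

text \<open>The faces of the radial graph are quadrilaterals, one for each edge \<open>{d, alpha d}\<close>, so
  alpha-closed sets of darts stand for sets of faces of the radial graph. The quadrilaterals of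
  \<open>d\<close> and \<open>sigma d\<close> share the radial edge \<open>sigma d\<close>.\<close>

definition regions :: "'d set set" where
  "regions = {Y. Y \<subseteq> D \<and> alpha ` Y = Y}"

definition boundary :: "'d set \<Rightarrow> 'd set" where
  "boundary Y = sym_diff Y (sigma ` Y)"

lemma region_subset: "Y \<in> regions \<Longrightarrow> Y \<subseteq> D"
  by (simp add: regions_def)

lemma region_alpha: "Y \<in> regions \<Longrightarrow> d \<in> D \<Longrightarrow> alpha d \<in> Y \<longleftrightarrow> d \<in> Y"
  unfolding regions_def by (auto simp: alpha_alpha) (metis alpha_alpha image_eqI)

lemma regionI:
  assumes "Y \<subseteq> D" "\<And>d. d \<in> Y \<Longrightarrow> alpha d \<in> Y"
  shows "Y \<in> regions"
  using assms unfolding regions_def by (auto simp: image_iff) (metis alpha_alpha subsetD)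

lemma sym_diff_region:
  assumes "Y \<in> regions" "Z \<in> regions"
  shows "sym_diff Y Z \<in> regions"
  using assms [THEN region_subset] assms [THEN region_alpha] by (intro regionI) auto

lemma finite_regions: "finite regions"
  by (rule finite_subset [of _ "Pow D"]) (auto simp: regions_def finite_D)

lemma boundary_subset: "Y \<in> regions \<Longrightarrow> boundary Y \<subseteq> D"
  unfolding boundary_def using region_subset sigma_in by blast

lemma sigma_in_boundary_iff:
  "Y \<in> regions \<Longrightarrow> d \<in> D \<Longrightarrow> sigma d \<in> boundary Y \<longleftrightarrow> (sigma d \<in> Y) \<noteq> (d \<in> Y)"
  by (auto simp: boundary_def sigma_image_iff region_subset)

lemma boundary_sym_diff:
  assumes "Y \<in> regions" "Z \<in> regions"
  shows "boundary (sym_diff Y Z) = sym_diff (boundary Y) (boundary Z)"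
proof -
  have "sigma ` sym_diff Y Z = sym_diff (sigma ` Y) (sigma ` Z)"
    using assms [THEN region_subset] bij_sigma
    by (simp add: bij_betw_def image_Un inj_on_image_set_diff [where C = D] subset_eq)
  then show ?thesis
    unfolding boundary_def by blast
qed

text \<open>\<open>g\<close> carries the fibre of \<open>h\<close> in \<open>Y\<close> bijectively
  to the fibre in the image of \<open>Y\<close>, and two sets of equal finite size have a symmetric
  difference of even size.\<close>

lemma even_card_boundary_fibre:
  assumes Y: "Y \<subseteq> D" and g: "inj_on g D" and h: "\<And>d. d \<in> D \<Longrightarrow> h (g d) = h d"
  shows "even (card {e \<in> sym_diff Y (g ` Y). h e = w})"
proof -
  have "{e \<in> sym_diff Y (g ` Y). h e = w} = sym_diff {e \<in> Y. h e = w} (g ` {e \<in> Y. h e = w})"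
    using Y h by auto
  moreover have "card (g ` {e \<in> Y. h e = w}) = card {e \<in> Y. h e = w}"
    using Y g by (intro card_image) (auto intro: inj_on_subset)
  moreover have "finite {e \<in> Y. h e = w}"
    using Y finite_D by (auto intro: finite_subset)
  ultimately show ?thesis
    using odd_card_sym_diff [of "{e \<in> Y. h e = w}" "g ` {e \<in> Y. h e = w}"] by simp
qed

text \<open>Since \<open>alpha\<close> preserves \<open>Y\<close>, the images of \<open>Y\<close>
  under \<open>sigma\<close> and \<open>phi\<close> agree. The same boundary can thus be read along
  rotations, for even degrees at vertices, and along boundary walks, for even degrees at face
  vertices.\<close>

lemma odd_vertices_boundary:
  assumes Y: "Y \<in> regions"
  shows "odd_vertices ends (boundary Y) = {}"
proof -
  have "(\<lambda>d. sigma (alpha d)) ` Y = sigma ` Y"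
    using Y by (simp add: regions_def flip: image_image)
  then have faces: "even (card {e \<in> boundary Y. face e = F})" for F
    using even_card_boundary_fibre [OF region_subset [OF Y] inj_phi, of face F] face_phi
    by (simp add: boundary_def comp_def)
  have "inj_on sigma D"
    using bij_sigma by (simp add: bij_betw_def)
  then have tails: "even (card {e \<in> boundary Y. tail e = v})" for v
    using even_card_boundary_fibre [OF region_subset [OF Y], of sigma tail v] tail_sigma
    by (simp add: boundary_def)
  have "even (card {e \<in> boundary Y. w \<in> ends e})" for w
    using tails faces by (cases w) (simp_all add: radial_ends_def eq_commute)
  then show ?thesis
    by (simp add: odd_vertices_def)
qed

text \<open>Without boundary, membership passes along \<open>sigma\<close> as well as
  \<open>alpha\<close>, and connectedness spreads it to all darts.\<close>

lemma boundary_empty: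
  assumes Y: "Y \<in> regions" and "boundary Y = {}"
  shows "Y = {} \<or> Y = D"
proof (cases "Y = {}")
  case False
  then obtain d where d: "d \<in> Y"
    by blast
  have "x \<in> Y" if "x \<in> D" for x
  proof (rule connected_induct [of d])
    show "sigma x \<in> Y" if "x \<in> D" "x \<in> Y" for x
      using sigma_in_boundary_iff [OF Y \<open>x \<in> D\<close>] assms(2) that by simp
  qed (use d that region_subset [OF Y] region_alpha [OF Y] in auto)
  then show ?thesis
    using region_subset [OF Y] by blast
qed simp

text \<open>The map sending a dart set \<open>Y\<close> to its symmetric difference with \<open>alpha ` Y\<close> has the regions
  as its kernel and takes values in the regions.\<close>

lemma power2_card_regions: "2 ^ card D \<le> card regions ^ 2"
proof -
  define f where "f Y = sym_diff Y (alpha ` Y)" for Y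
  have inj: "inj_on alpha D"
    by (rule inj_on_inverseI) (rule alpha_alpha)
  have "card (Pow D) = card (f ` Pow D) * card {Y \<in> Pow D. f Y = {}}"
  proof (rule card_image_times_kernel)
    fix A B
    assume AB: "A \<in> Pow D" "B \<in> Pow D"
    then have "alpha ` sym_diff A B = sym_diff (alpha ` A) (alpha ` B)"
      using inj by (simp add: image_Un inj_on_image_set_diff [where C = D] subset_eq)
    then show "f (sym_diff A B) = sym_diff (f A) (f B)"
      unfolding f_def by blast
  qed (use finite_D in auto)
  moreover have "f ` Pow D \<subseteq> regions"
  proof -
    have "f Y \<in> regions" if "Y \<subseteq> D" for Y
    proof (rule regionI)
      show "f Y \<subseteq> D"
        using that alpha_in by (auto simp: f_def)
      fix d
      assume "d \<in> f Y"
      then consider "d \<in> Y" "d \<notin> alpha ` Y" | "d \<notin> Y" "d \<in> alpha ` Y"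
        by (auto simp: f_def)
      then show "alpha d \<in> f Y"
      proof cases
        case 1
        moreover have "d = alpha (alpha d)"
          using 1(1) that alpha_alpha [of d] by auto
        ultimately have "alpha d \<notin> Y"
          by blast
        then show ?thesis
          using 1 by (simp add: f_def)
      next
        case 2
        then obtain y where y: "y \<in> Y" "d = alpha y"
          by blast
        then have "alpha d = y"
          using that alpha_alpha by blast
        moreover have "y \<notin> alpha ` Y"
          using y 2(1) that by (auto simp: alpha_alpha subset_eq)
        ultimately show ?thesis
          using y by (simp add: f_def)
      qed
    qed
    then show ?thesis
      by blast
  qed
  then have "card (f ` Pow D) \<le> card regions"
    by (intro card_mono finite_regions)
  moreover have "{Y \<in> Pow D. f Y = {}} = regions"
    by (auto simp: f_def regions_def)
  \<comment> \<open>Image and kernel each have at most \<open>card regions\<close> members, which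
    gives the square.\<close>
  ultimately show ?thesis
    using finite_D by (simp add: card_Pow power2_eq_square)
qed

text \<open>Only the empty set and \<open>D\<close> can have empty boundary, so each boundary arises
  from at most two regions. Squaring avoids halving \<open>card D\<close>.\<close>

lemma power2_card_boundaries: "2 ^ card D \<le> 4 * card (boundary ` regions) ^ 2"
proof -
  have "{Y \<in> regions. boundary Y = {}} \<subseteq> {{}, D}"
    by (auto dest: boundary_empty)
  then have "card {Y \<in> regions. boundary Y = {}} \<le> card {{}, D}"
    by (rule card_mono [rotated]) simp
  also have "\<dots> \<le> 2"
    by (cases "D = {}") simp_all
  finally have kernel: "card {Y \<in> regions. boundary Y = {}} \<le> 2" .
  have "card regions = card (boundary ` regions) * card {Y \<in> regions. boundary Y = {}}"
    by (rule card_image_times_kernel [OF finite_regions sym_diff_region boundary_sym_diff])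
  also have "\<dots> \<le> card (boundary ` regions) * 2"
    using kernel by (rule mult_le_mono2)
  finally have "card regions ^ 2 \<le> (card (boundary ` regions) * 2) ^ 2"
    by (rule power_mono) simp
  also have "\<dots> = 4 * card (boundary ` regions) ^ 2"
    by (simp add: power_mult_distrib)
  finally show ?thesis
    using power2_card_regions by (rule order_trans [rotated])
qed

subsection \<open>A homological Jordan curve theorem\<close>

text \<open>The radial graph is connected with \<open>card D\<close> edges, and by Euler's formula
  its vertices number half of \<open>card D\<close> plus two. This bounds its cycle space from
  above; squares again avoid the halving.\<close>

lemma power2_card_even_radial:
  "2 ^ card D * card {A \<in> Pow D. odd_vertices ends A = {}} ^ 2 * 4 \<le> (2 ^ card D) ^ 2"
proof -
  define W where "W = Inl ` tail ` D \<union> (Inr ` face ` D :: ('v + 'd set) set)"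
  define I where "I = odd_vertices ends ` Pow D"
  have finW: "finite W"
    using finite_D by (simp add: W_def)
  have cardW: "card W = card (tail ` D) + card (face ` D)"
    unfolding W_def using finite_D by (subst card_Un_disjoint) (auto simp: card_image)
  have "D \<noteq> {}"
    using euler by auto
  then obtain d0 where d0: "d0 \<in> D"
    by blast
  define w0 :: "'v + 'd set" where "w0 = Inl (tail d0)"
  have add_edge: "sym_diff {w'} {w0} \<in> I"
    if "sym_diff {w} {w0} \<in> I" "d \<in> D" "ends d = {w, w'}" "w \<noteq> w'" for w w' d
  proof -
    obtain A where A: "A \<subseteq> D" "sym_diff {w} {w0} = odd_vertices ends A"
      using \<open>sym_diff {w} {w0} \<in> I\<close> unfolding I_def by blast
    have "odd_vertices ends (sym_diff A {d}) = sym_diff (sym_diff {w} {w0}) {w, w'}"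
      using A that finite_D by (subst odd_vertices_sym_diff)
        (auto simp: odd_vertices_singleton intro: finite_subset)
    also have "\<dots> = sym_diff {w'} {w0}"
      using \<open>w \<noteq> w'\<close> by blast
    finally have "sym_diff {w'} {w0} = odd_vertices ends (sym_diff A {d})" ..
    moreover have "sym_diff A {d} \<in> Pow D"
      using A that by blast
    ultimately show ?thesis
      unfolding I_def by blast
  qed
  \<comment> \<open>Both ends of the radial edge \<open>d\<close> are connected to the root
    \<open>w0\<close>, phrased through odd vertices of edge sets.\<close>
  define P where "P d \<longleftrightarrow> sym_diff {Inl (tail d)} {w0} \<in> I \<and> sym_diff {Inr (face d)} {w0} \<in> I" for d
  have from_tail: "P d" if "sym_diff {Inl (tail d)} {w0} \<in> I" "d \<in> D" for d
    using that add_edge [of "Inl (tail d)" d "Inr (face d)"] by (auto simp: P_def radial_ends_def)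
  have from_face: "P d" if "sym_diff {Inr (face d)} {w0} \<in> I" "d \<in> D" for d
    using that add_edge [of "Inr (face d)" d "Inl (tail d)"]
    by (auto simp: P_def radial_ends_def insert_commute)
  have "sym_diff {Inl (tail d0)} {w0} = odd_vertices ends {}"
    by (simp add: w0_def odd_vertices_def)
  then have "sym_diff {Inl (tail d0)} {w0} \<in> I"
    unfolding I_def by blast
  then have P0: "P d0"
    using d0 by (rule from_tail)
  have P: "P d" if "d \<in> D" for d
  proof (rule connected_induct [of d0])
    show P_sigma: "P (sigma x)" if "x \<in> D" "P x" for x
      using that by (intro from_tail sigma_in) (auto simp: P_def tail_sigma)
    \<comment> \<open>\<open>alpha x\<close> and \<open>sigma x\<close> lie in a common face, so the
      connection passes through its face vertex.\<close>
    show "P (alpha x)" if "x \<in> D" "P x" for x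
      using P_sigma [OF that] that(1) by (intro from_face alpha_in) (auto simp: P_def face_alpha)
  qed (use d0 P0 that in auto)
  have "2 ^ card W * card {A \<in> Pow D. odd_vertices ends A = {}} \<le> 2 * 2 ^ card D"
    by (rule card_even_edge_sets_le [where r = w0])
      (use finite_D finW P in \<open>auto simp: W_def P_def I_def\<close>)
  then have "(2 ^ card W * card {A \<in> Pow D. odd_vertices ends A = {}}) ^ 2 \<le> (2 * 2 ^ card D) ^ 2"
    by (rule power_mono) simp
  moreover have "((2::nat) ^ card W) ^ 2 = 2 ^ card D * 16"
  proof -
    have "card W * 2 = card D + 4"
      using cardW euler by simp
    then show ?thesis
      by (simp add: power_add flip: power_mult)
  qed
  ultimately show ?thesis
    by (simp add: power_mult_distrib)
qed

text \<open>The first homology of the sphere vanishes modulo 2: boundaries are even sets, and the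
  two counting bounds leave no room for any other even set.\<close>

lemma even_radial_is_boundary:
  assumes "A \<subseteq> D" "odd_vertices ends A = {}"
  obtains Y where "Y \<in> regions" "boundary Y = A"
proof -
  define ev where "ev = {A \<in> Pow D. odd_vertices ends A = {}}"
  have "finite ev"
    using finite_D by (simp add: ev_def)
  moreover have "boundary ` regions \<subseteq> ev"
    by (rule image_subsetI) (simp add: ev_def boundary_subset odd_vertices_boundary)
  moreover have "card ev \<le> card (boundary ` regions)"
  proof (rule power2_le_imp_le)
    have "2 ^ card D * (card ev ^ 2 * 4) \<le> 2 ^ card D * 2 ^ card D"
      using power2_card_even_radial unfolding ev_def [symmetric]
      by (simp only: power2_eq_square mult.assoc)
    then have "card ev ^ 2 * 4 \<le> 2 ^ card D"
      by simp
    also note power2_card_boundaries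
    finally show "card ev ^ 2 \<le> card (boundary ` regions) ^ 2"
      by simp
  qed simp
  ultimately have "boundary ` regions = ev"
    by (rule card_seteq)
  moreover have "A \<in> ev"
    using assms by (simp add: ev_def)
  ultimately obtain Y where "Y \<in> regions" "boundary Y = A"
    by (metis imageE)
  then show thesis
    by (rule that)
qed

text \<open>A separating region whose boundary has the fewest edges: if a cycle contained in its
  boundary did not separate as well, then adding the region enclosed by the cycle would remove the
  cycle from the boundary.\<close>

lemma ex_separating_cycle:
  assumes X: "X \<in> regions" and p: "p \<in> D" and q: "q \<in> D" and sep: "(p \<in> X) \<noteq> (q \<in> X)"
  obtains vs es Y where "mg_cycle ends D vs es" "set es \<subseteq> boundary X"
    "Y \<in> regions" "boundary Y = set es" "(p \<in> Y) \<noteq> (q \<in> Y)"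
proof -
  \<comment> \<open>Keeping the boundary within \<open>boundary X\<close> ensures that the final
    cycle uses only edges of \<open>boundary X\<close>.\<close>
  define Q where "Q Z \<longleftrightarrow> Z \<in> regions \<and> boundary Z \<subseteq> boundary X \<and> (p \<in> Z) \<noteq> (q \<in> Z)" for Z
  have "Q X"
    using X sep by (simp add: Q_def)
  then obtain Z where Z: "Q Z" and Z_min: "\<And>Z'. Q Z' \<Longrightarrow> card (boundary Z) \<le> card (boundary Z')"
    using ex_has_least_nat [of Q X "\<lambda>Z. card (boundary Z)"] by blast
  have Zr: "Z \<in> regions" and ZX: "boundary Z \<subseteq> boundary X" and Zsep: "(p \<in> Z) \<noteq> (q \<in> Z)"
    using Z by (simp_all add: Q_def)
  have finZ: "finite (boundary Z)"
    using boundary_subset [OF Zr] finite_D finite_subset by blast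
  have "boundary Z \<noteq> {}"
    using boundary_empty [OF Zr] Zsep p q by blast
  moreover have "card (ends e) = 2" for e
    by (simp add: radial_ends_def)
  moreover have "card {e \<in> boundary Z. w \<in> ends e} \<noteq> 1" for w
  proof -
    have "w \<notin> odd_vertices ends (boundary Z)"
      by (simp add: odd_vertices_boundary [OF Zr])
    then have "even (card {e \<in> boundary Z. w \<in> ends e})"
      by (simp add: odd_vertices_def)
    then show ?thesis
      by (metis odd_one)
  qed
  ultimately obtain vs es where cyc: "mg_cycle ends (boundary Z) vs es"
    using ex_mg_cycle [OF finZ] by metis
  then have esZ: "set es \<subseteq> boundary Z" and es_ne: "set es \<noteq> {}"
    by (auto simp: mg_cycle_def)
  have cycD: "mg_cycle ends D vs es"
    using cyc boundary_subset [OF Zr] by (auto simp: mg_cycle_def)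
  obtain Y where Y: "Y \<in> regions" "boundary Y = set es"
    using even_radial_is_boundary [of "set es"] mg_cycle_even [OF cyc] esZ boundary_subset [OF Zr]
    by blast
  have "(p \<in> Y) \<noteq> (q \<in> Y)"
  proof
    assume pq: "(p \<in> Y) = (q \<in> Y)"
    \<comment> \<open>\<open>Y\<close> does not tell \<open>p\<close> from \<open>q\<close> here, so
      adding it to \<open>Z\<close> keeps them apart; as its boundary lies in that of
      \<open>Z\<close>, this only deletes edges.\<close>
    have diff: "boundary (sym_diff Z Y) = boundary Z - set es"
      using boundary_sym_diff [OF Zr Y(1)] Y(2) esZ by blast
    have "Q (sym_diff Z Y)"
      unfolding Q_def diff using sym_diff_region [OF Zr Y(1)] ZX Zsep pq by blast
    then have "card (boundary Z) \<le> card (boundary Z - set es)"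
      using Z_min diff by metis
    moreover obtain e where "e \<in> set es"
      using es_ne by (cases es) auto
    then have "boundary Z - set es \<subset> boundary Z"
      using esZ by blast
    then have "card (boundary Z - set es) < card (boundary Z)"
      by (rule psubset_card_mono [OF finZ])
    ultimately show False
      by simp
  qed
  then show thesis
    using that cycD esZ ZX Y by blast
qed

text \<open>Crossing an edge of the planarization stays within an \<open>alpha\<close>-closed set or
  its complement, and so does crossing a radial edge off the boundary. Hence \<open>Y\<close> is a
  union of sides.\<close>

lemma side_rel_region:
  assumes Y: "Y \<in> regions" and "p \<in> D" and "(p, q) \<in> side_rel D alpha sigma (boundary Y)"
  shows "q \<in> D \<and> (q \<in> Y \<longleftrightarrow> p \<in> Y)"
proof -
  let ?r = "{(d, alpha d) | d. d \<in> D} \<union>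
    {(d, sigma (alpha d)) | d. d \<in> D \<and> sigma (alpha d) \<notin> boundary Y}"
  have step: "x \<in> D \<and> y \<in> D \<and> (y \<in> Y \<longleftrightarrow> x \<in> Y)" if "(x, y) \<in> ?r \<union> ?r\<inverse>" for x y
    using that by (auto simp: alpha_in sigma_in region_alpha [OF Y] sigma_in_boundary_iff [OF Y])
  have "(p, q) \<in> (?r \<union> ?r\<inverse>)\<^sup>*"
    using assms(3) by (simp add: side_rel_def Let_def)
  then show ?thesis
    by (induction rule: rtrancl_induct) (use \<open>p \<in> D\<close> step in blast)+
qed

text \<open>Rotating about a vertex crosses only radial edges at that vertex, none of which lies on
  the boundary.\<close>

lemma region_same_tail:
  assumes Y: "Y \<in> regions" and d: "d \<in> D" "d' \<in> D" "tail d = tail d'"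
    and avoid: "\<And>e. e \<in> boundary Y \<Longrightarrow> tail e \<noteq> tail d"
  shows "d \<in> Y \<longleftrightarrow> d' \<in> Y"
proof -
  have "(sigma ^^ n) d \<in> Y \<longleftrightarrow> d \<in> Y" for n
  proof (induction n)
    case (Suc n)
    then show ?case
      using sigma_in_boundary_iff [OF Y sigma_funpow_in [OF d(1)], of n]
        avoid [of "(sigma ^^ Suc n) d"] tail_funpow [OF d(1), of "Suc n"] by auto
  qed simp
  then show ?thesis
    using same_tail [OF d] by blast
qed

end

section \<open>Planarizations of full 1-plane graphs\<close>

locale one_plane_map = sphere_map D alpha sigma tail
  for D :: "'d set" and alpha sigma :: "'d \<Rightarrow> 'd" and tail :: "'d \<Rightarrow> 'v" +
  fixes dummy :: "'v set"
  assumes one_plane: "one_plane_planarization D alpha sigma tail dummy"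
begin

section \<open>Crossings and adjacency in \<open>G\<close>\<close>

abbreviation hd :: "'d \<Rightarrow> 'v" where
  "hd \<equiv> head alpha tail"

abbreviation adj :: "'v \<Rightarrow> 'v \<Rightarrow> bool" where
  "adj \<equiv> gadj D alpha sigma tail dummy"

lemma card_dummy: "c \<in> dummy \<Longrightarrow> card {d \<in> D. tail d = c} = 4"
  and hd_dummy: "d \<in> D \<Longrightarrow> tail d \<in> dummy \<Longrightarrow> hd d \<notin> dummy"
  and distinct_hds: "d \<in> D \<Longrightarrow> tail d \<in> dummy \<Longrightarrow>
    distinct [hd d, hd (sigma d), hd (sigma (sigma d)), hd (sigma (sigma (sigma d)))]"
  using one_plane unfolding one_plane_planarization_def by blast+

text \<open>The four rotated darts have distinct heads, hence are distinct, and the degree leaves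
  room for no others.\<close>

lemma darts_at_dummy:
  assumes d: "d \<in> D" "tail d \<in> dummy"
  shows "{x \<in> D. tail x = tail d} = {d, sigma d, sigma (sigma d), sigma (sigma (sigma d))}"
proof -
  let ?ds = "[d, sigma d, sigma (sigma d), sigma (sigma (sigma d))]"
  have "distinct (map hd ?ds)"
    using distinct_hds [OF d] by simp
  then have "card (set ?ds) = length ?ds"
    unfolding distinct_map by (intro distinct_card) (rule conjunct1)
  also have "\<dots> = 4"
    by simp
  finally have four: "card {d, sigma d, sigma (sigma d), sigma (sigma (sigma d))} = 4"
    by (simp only: list.set)
  have "{d, sigma d, sigma (sigma d), sigma (sigma (sigma d))} \<subseteq> {x \<in> D. tail x = tail d}"
    using d by (auto simp: sigma_in tail_sigma)
  moreover have "finite {x \<in> D. tail x = tail d}"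
    using finite_D by simp
  ultimately show ?thesis
    by (intro card_subset_eq [symmetric]) (simp_all only: four card_dummy [OF d(2)])
qed

lemma sigma_order_4:
  assumes d: "d \<in> D" "tail d \<in> dummy"
  shows "sigma (sigma (sigma (sigma d))) = d"
proof -
  have "sigma (sigma (sigma (sigma d))) \<in> {x \<in> D. tail x = tail d}"
    using d by (simp add: sigma_in tail_sigma)
  then have "sigma (sigma (sigma (sigma d))) \<in> {d, sigma d, sigma (sigma d), sigma (sigma (sigma d))}"
    by (simp only: darts_at_dummy [OF d])
  \<comment> \<open>Any other value would, by injectivity of \<open>sigma\<close>, make two of the
    four darts coincide.\<close>
  then show ?thesis
    using distinct_hds [OF d] d(1) by (auto simp: sigma_eq_iff sigma_in)
qed

lemma gadj_sym:
  assumes "adj x y"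
  shows "adj y x"
proof -
  consider d where "d \<in> D" "tail d = x" "hd d = y" "x \<notin> dummy" "y \<notin> dummy"
    | d where "d \<in> D" "tail d \<in> dummy" "hd d = x" "hd (sigma (sigma d)) = y"
    using assms unfolding gadj_def by blast
  then show ?thesis
  proof cases
    case 1
    then have "alpha d \<in> D" "tail (alpha d) = y" "hd (alpha d) = x"
      by (simp_all add: alpha_in alpha_alpha head_def)
    then show ?thesis
      using 1 unfolding gadj_def by blast
  next
    \<comment> \<open>Reversing a crossed edge means starting from the opposite dart; two further
      rotations lead back to \<open>d\<close>.\<close>
    case 2
    then have "sigma (sigma d) \<in> D" "tail (sigma (sigma d)) \<in> dummy"
      "hd (sigma (sigma (sigma (sigma d)))) = x"
      by (simp_all add: sigma_in tail_sigma sigma_order_4)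
    then show ?thesis
      using 2 unfolding gadj_def by blast
  qed
qed

lemma gadj_not_dummy: "adj x y \<Longrightarrow> y \<notin> dummy"
  using gadj_sym unfolding gadj_def by (metis hd_dummy)

text \<open>Consecutive endpoints are adjacent by fullness, and opposite ones are the ends of one of
  the two crossing edges.\<close>

lemma crossing_endpoints_adjacent:
  assumes full: "full D alpha sigma tail dummy"
    and d: "d \<in> D" "tail d \<in> dummy" "d' \<in> D" "tail d' = tail d"
  shows "hd d' = hd d \<or> adj (hd d) (hd d')"
proof -
  have "d' \<in> {d, sigma d, sigma (sigma d), sigma (sigma (sigma d))}"
    using darts_at_dummy [OF d(1,2)] d by blast
  then consider "d' = d" | "d' = sigma d" | "d' = sigma (sigma d)" | "d = sigma d'"
    using sigma_order_4 [OF d(1,2)] by auto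
  then show ?thesis
  proof cases
    case 4
    then have "adj (hd d') (hd d)"
      using full d by (auto simp: full_def)
    then show ?thesis
      by (blast intro: gadj_sym)
  next
    case 3
    then show ?thesis
      using d unfolding gadj_def by blast
  qed (use full d in \<open>auto simp: full_def\<close>)
qed

text \<open>A crossed edge of the graph passes through a dummy vertex, so no edge of the graph leads from
  one side of a dummy-free radial cycle to the other.\<close>

lemma gadj_same_region:
  assumes Y: "Y \<in> regions" and "adj x y"
    and avoid: "\<And>e. e \<in> boundary Y \<Longrightarrow> tail e \<notin> dummy \<and> tail e \<noteq> x \<and> tail e \<noteq> y"
    and dx: "dx \<in> D" "tail dx = x" and dy: "dy \<in> D" "tail dy = y"
  shows "dx \<in> Y \<longleftrightarrow> dy \<in> Y"
proof -
  have at_x: "d \<in> Y \<longleftrightarrow> dx \<in> Y" if "d \<in> D" "tail d = x" for d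
    by (rule region_same_tail [OF Y]) (simp_all add: avoid dx that)
  have at_y: "d \<in> Y \<longleftrightarrow> dy \<in> Y" if "d \<in> D" "tail d = y" for d
    by (rule region_same_tail [OF Y]) (simp_all add: avoid dy that)
  consider d where "d \<in> D" "tail d = x" "hd d = y"
    | d where "d \<in> D" "tail d \<in> dummy" "hd d = x" "hd (sigma (sigma d)) = y"
    using \<open>adj x y\<close> unfolding gadj_def by blast
  then show ?thesis
  proof cases
    case 1
    have "d \<in> Y \<longleftrightarrow> dx \<in> Y"
      using 1(1,2) by (rule at_x)
    moreover have "alpha d \<in> Y \<longleftrightarrow> dy \<in> Y"
      using alpha_in [OF 1(1)] 1(3) [unfolded head_def] by (rule at_y)
    ultimately show ?thesis
      by (simp only: region_alpha [OF Y 1(1)])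
  next
    case 2
    have ss: "sigma (sigma d) \<in> D"
      using 2(1) by (simp add: sigma_in)
    have "d \<in> Y \<longleftrightarrow> sigma (sigma d) \<in> Y"
    proof (rule region_same_tail [OF Y 2(1) ss])
      show "tail d = tail (sigma (sigma d))"
        using 2(1) by (simp add: tail_sigma sigma_in)
      show "tail e \<noteq> tail d" if "e \<in> boundary Y" for e
        using avoid [OF that] 2(2) by auto
    qed
    moreover have "alpha d \<in> Y \<longleftrightarrow> dx \<in> Y"
      using alpha_in [OF 2(1)] 2(3) [unfolded head_def] by (rule at_x)
    moreover have "alpha (sigma (sigma d)) \<in> Y \<longleftrightarrow> dy \<in> Y"
      using alpha_in [OF ss] 2(4) [unfolded head_def] by (rule at_y)
    ultimately show ?thesis
      by (simp only: region_alpha [OF Y 2(1)] region_alpha [OF Y ss])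
  qed
qed

section \<open>Components of \<open>G - S\<close> and their regions\<close>

definition reach :: "'v set \<Rightarrow> 'v \<Rightarrow> 'v \<Rightarrow> bool" where
  "reach S = (\<lambda>x y. adj x y \<and> x \<notin> S \<and> y \<notin> S)\<^sup>*\<^sup>*"

lemma separating_iff:
  "separating D alpha sigma tail dummy S \<longleftrightarrow> S \<subseteq> gV D tail dummy \<and>
    (\<exists>u v. u \<in> gV D tail dummy - S \<and> v \<in> gV D tail dummy - S \<and> \<not> reach S u v)"
  by (simp add: separating_def reach_def)

lemma reach_refl: "reach S u u"
  by (simp add: reach_def)

lemma reach_step:
  assumes "reach S u x" "adj x y" "x \<notin> S" "y \<notin> S"
  shows "reach S u y"
  unfolding reach_def
  by (rule rtranclp.rtrancl_into_rtrancl [OF assms(1) [unfolded reach_def]]) (simp add: assms)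

lemma reach_gV:
  assumes "u \<in> gV D tail dummy - S" "reach S u x"
  shows "x \<notin> S \<and> x \<notin> dummy"
  using assms(2) unfolding reach_def
  by (induction rule: rtranclp_induct) (use assms(1) in \<open>auto simp: gV_def dest: gadj_not_dummy\<close>)

text \<open>Fullness makes the non-separator endpoints of a crossing pairwise adjacent, so each dummy
  vertex can be attributed to at most one component of the graph without the separator.\<close>

lemma ex_component_region:
  assumes full: "full D alpha sigma tail dummy" and u: "u \<in> gV D tail dummy - S"
  obtains X where "X \<in> regions" "tail ` boundary X \<subseteq> S"
    "\<And>d. d \<in> D \<Longrightarrow> tail d \<in> gV D tail dummy - S \<Longrightarrow> d \<in> X \<longleftrightarrow> reach S u (tail d)"
proof -
  \<comment> \<open>The component of \<open>u\<close>, together with every dummy vertex that has an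
    endpoint in it.\<close>
  define K where "K = {x. reach S u x} \<union> {c \<in> dummy. \<exists>d\<in>D. tail d = c \<and> reach S u (hd d)}"
  \<comment> \<open>The edges of the planarization that touch \<open>K\<close>; the form symmetric
    in both ends makes \<open>X\<close> closed under \<open>alpha\<close>.\<close>
  define X where "X = {d \<in> D. tail d \<in> K \<or> hd d \<in> K}"
  note r = reach_gV [OF u]
  \<comment> \<open>In the planarization, \<open>K\<close> can be left only into \<open>S\<close>.
    At a dummy vertex this is where fullness enters.\<close>
  have hd_K: "hd d \<in> K" if d: "d \<in> D" "tail d \<in> K" "hd d \<notin> S" for d
  proof (cases "tail d \<in> dummy")
    case True
    then obtain d' where d': "d' \<in> D" "tail d' = tail d" "reach S u (hd d')"
      using d(2) r by (auto simp: K_def)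
    then have "hd d = hd d' \<or> adj (hd d') (hd d)"
      using True d(1) by (intro crossing_endpoints_adjacent [OF full]) auto
    then have "reach S u (hd d)"
      using d' d(3) r reach_step by metis
    then show ?thesis
      by (simp add: K_def)
  next
    case False
    then have reach: "reach S u (tail d)"
      using d(2) by (simp add: K_def)
    show ?thesis
    proof (cases "hd d \<in> dummy")
      case True
      moreover have "alpha d \<in> D" "tail (alpha d) = hd d" "hd (alpha d) = tail d"
        using d(1) by (simp_all add: alpha_in alpha_alpha head_def)
      ultimately show ?thesis
        using reach unfolding K_def by force
    next
      case hd: False
      then have "adj (tail d) (hd d)"
        using d(1) False unfolding gadj_def by blast
      then have "reach S u (hd d)"
        using reach d(3) r reach_step by metis
      then show ?thesis
        by (simp add: K_def)
    qed
  qed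
  \<comment> \<open>Away from \<open>S\<close>, membership in \<open>X\<close> depends on the tail
    only, so rotation does not change it; this confines the boundary to radial edges at
    \<open>S\<close>.\<close>
  have in_X: "d \<in> X \<longleftrightarrow> tail d \<in> K" if d: "d \<in> D" "tail d \<notin> S" for d
  proof -
    have "alpha d \<in> D" "tail (alpha d) = hd d" "hd (alpha d) = tail d"
      using d(1) by (simp_all add: alpha_in alpha_alpha head_def)
    then show ?thesis
      using hd_K [of "alpha d"] d by (auto simp: X_def)
  qed
  have X: "X \<in> regions"
    by (rule regionI) (auto simp: X_def head_def alpha_in alpha_alpha)
  moreover have "tail ` boundary X \<subseteq> S"
  proof
    fix t
    assume "t \<in> tail ` boundary X"
    then obtain e where e: "e \<in> boundary X" "t = tail e"
      by blast
    then obtain d where d: "d \<in> D" "e = sigma d"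
      using boundary_subset [OF X] ex_sigma by blast
    then have "(sigma d \<in> X) \<noteq> (d \<in> X)"
      using sigma_in_boundary_iff [OF X] e(1) by blast
    then show "t \<in> S"
      using in_X [of d] in_X [of "sigma d"] d e(2) by (auto simp: sigma_in tail_sigma)
  qed
  moreover have "d \<in> X \<longleftrightarrow> reach S u (tail d)" if "d \<in> D" "tail d \<in> gV D tail dummy - S" for d
    using in_X [of d] that by (auto simp: K_def gV_def)
  ultimately show thesis
    using that by blast
qed

lemma gadj_dart:
  assumes "adj x y"
  obtains d where "d \<in> D" "tail d = x"
  using assms alpha_in unfolding gadj_def head_def by blast

text \<open>Induction along a path that avoids the tails of the boundary: by
  \<open>gadj_same_region\<close> each edge of \<open>G\<close> stays on one side.\<close>

lemma not_reach_across_boundary: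
  assumes Y: "Y \<in> regions" and dummy: "tail ` boundary Y \<inter> dummy = {}"
    and p: "p \<in> D" "tail p \<notin> tail ` boundary Y"
    and q: "q \<in> D" and sep: "(p \<in> Y) \<noteq> (q \<in> Y)"
  shows "\<not> reach (tail ` boundary Y) (tail p) (tail q)"
proof
  \<comment> \<open>The invariant ranges over all darts at the reached vertex, so that it applies to
    the given dart \<open>q\<close> at the end of the path.\<close>
  have same: "\<forall>d\<in>D. tail d = x \<longrightarrow> (p \<in> Y \<longleftrightarrow> d \<in> Y)" if "reach (tail ` boundary Y) (tail p) x" for x
    using that unfolding reach_def
  proof (induction rule: rtranclp_induct)
    case base
    show ?case
    proof (intro ballI impI)
      fix d
      assume "d \<in> D" "tail d = tail p"
      then show "p \<in> Y \<longleftrightarrow> d \<in> Y"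
        using p by (intro region_same_tail [OF Y]) (simp_all, metis imageI)
    qed
  next
    case (step x y)
    then have "adj x y" and xy: "x \<notin> tail ` boundary Y" "y \<notin> tail ` boundary Y"
      by blast+
    obtain d where d: "d \<in> D" "tail d = x"
      using \<open>adj x y\<close> by (rule gadj_dart)
    show ?case
    proof (intro ballI impI)
      fix d'
      assume d': "d' \<in> D" "tail d' = y"
      have "d \<in> Y \<longleftrightarrow> d' \<in> Y"
        by (rule gadj_same_region [OF Y \<open>adj x y\<close> _ d d']) (use xy dummy in blast)
      moreover have "p \<in> Y \<longleftrightarrow> d \<in> Y"
        using step.IH d by blast
      ultimately show "p \<in> Y \<longleftrightarrow> d' \<in> Y"
        by blast
    qed
  qed
  assume "reach (tail ` boundary Y) (tail p) (tail q)"
  then show False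
    using same q sep by blast
qed

end

section \<open>Construction of the separating radial cycle\<close>

theorem theorem4:
  fixes D :: "'d set" and alpha sigma :: "'d \<Rightarrow> 'd" and tail :: "'d \<Rightarrow> 'v"
    and dummy :: "'v set" and S :: "'v set"
  assumes "one_plane_planarization D alpha sigma tail dummy"
    and "g_connected D alpha sigma tail dummy"
    and "full D alpha sigma tail dummy"
    and "kite_assumption D alpha sigma tail dummy"
    and "minimal_separating D alpha sigma tail dummy S"
  shows "\<exists>vs es. mg_cycle (radial_ends alpha sigma tail) D vs es \<and>
           (\<forall>c\<in>dummy. Inl c \<notin> set vs) \<and>
           {v. Inl v \<in> set vs} \<inter> gV D tail dummy = S \<and>
           (\<exists>u w. u \<in> gV D tail dummy \<and> w \<in> gV D tail dummy \<and>
              Inl u \<notin> set vs \<and> Inl w \<notin> set vs \<and>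
              opposite_sides D alpha sigma tail (set es) u w)"
proof -
  interpret one_plane_map D alpha sigma tail dummy
    using assms(1) by unfold_locales (simp_all add: one_plane_planarization_def)
  have "separating D alpha sigma tail dummy S"
    and minimal: "\<And>T. T \<subset> S \<Longrightarrow> \<not> separating D alpha sigma tail dummy T"
    using assms(5) by (simp_all add: minimal_separating_def)
  then obtain u w where S: "S \<subseteq> gV D tail dummy" and u: "u \<in> gV D tail dummy - S"
    and w: "w \<in> gV D tail dummy - S" and uw: "\<not> reach S u w"
    unfolding separating_iff by blast
  obtain X where X: "X \<in> regions" "tail ` boundary X \<subseteq> S"
    and in_X: "\<And>d. d \<in> D \<Longrightarrow> tail d \<in> gV D tail dummy - S \<Longrightarrow> d \<in> X \<longleftrightarrow> reach S u (tail d)"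
    using ex_component_region [OF assms(3) u] by metis
  obtain p where p: "p \<in> D" "tail p = u"
    using u by (auto simp: gV_def)
  obtain q where q: "q \<in> D" "tail q = w"
    using w by (auto simp: gV_def)
  have "p \<in> X" "q \<notin> X"
    using in_X [of p] in_X [of q] p q u w uw by (simp_all add: reach_refl)
  then have "(p \<in> X) \<noteq> (q \<in> X)"
    by simp
  then obtain vs es Y where cyc: "mg_cycle ends D vs es" and es: "set es \<subseteq> boundary X"
    and Y: "Y \<in> regions" "boundary Y = set es" and sep: "(p \<in> Y) \<noteq> (q \<in> Y)"
    using ex_separating_cycle [OF X(1) p(1) q(1)] by metis
  \<comment> \<open>Each radial edge has exactly one end that is not a face vertex, namely its
    tail.\<close>
  have vs_iff: "Inl v \<in> set vs \<longleftrightarrow> v \<in> tail ` set es" for v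
  proof
    assume "Inl v \<in> set vs"
    then show "v \<in> tail ` set es"
      using mg_cycle_vertex_in_edge [OF cyc] by (auto simp: radial_ends_def)
  next
    assume "v \<in> tail ` set es"
    then show "Inl v \<in> set vs"
      using mg_cycle_edge_ends [OF cyc] by (auto simp: radial_ends_def)
  qed
  have sub: "tail ` set es \<subseteq> S"
    using es X(2) by blast
  have dummy: "tail ` set es \<inter> dummy = {}"
    using sub S by (auto simp: gV_def)
  have out: "u \<notin> tail ` set es" "w \<notin> tail ` set es"
    using sub u w by blast+
  \<comment> \<open>The vertices of \<open>G\<close> on the cycle already separate \<open>u\<close>
    from \<open>w\<close>, so by minimality they cannot form a proper subset of
    \<open>S\<close>.\<close>
  have "\<not> reach (tail ` set es) u w"
    using not_reach_across_boundary [OF Y(1), of p q] Y(2) dummy out p q sep by simp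
  then have "separating D alpha sigma tail dummy (tail ` set es)"
    unfolding separating_iff using sub S u w by blast
  then have S_eq: "tail ` set es = S"
    using minimal sub by blast
  \<comment> \<open>\<open>Y\<close> is a union of sides of the cycle and contains exactly one of
    the darts \<open>p\<close> and \<open>q\<close>.\<close>
  have "(p, q) \<notin> side_rel D alpha sigma (set es)"
    using side_rel_region [OF Y(1) p(1)] Y(2) sep by metis
  then have "opposite_sides D alpha sigma tail (set es) u w"
    unfolding opposite_sides_def using p q by blast
  moreover have "{v. Inl v \<in> set vs} = S"
    by (simp add: vs_iff S_eq)
  moreover have "\<forall>c\<in>dummy. Inl c \<notin> set vs"
    using dummy by (auto simp: vs_iff)
  ultimately show ?thesis
    using cyc S u w out by (intro exI [of _ vs] exI [of _ es]) (auto simp: vs_iff)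
qed

end
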